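(* Let $t_0$ be an initial seed and $\Delta^+$ the set of seeds obtained from it by finite sequences of mutations. For every $t\in\Delta^+$ let a subset $\mathcal Z(t)=\{Z_n(t)\mid n\in\mathbb{Z}^I\}\subset\mathcal{LP}^X(t)$ be given, where $Z_n(t)=X(t)^n\cdot F_n(t)$ with $F_n(t)=\sum_{e\in\mathbb{N}^{I_{\mathrm{uf}}}}c_e(n;t)X(t)^e$ a polynomial, $c_e(n;t)\in\Bbbk$, $c_0(n;t)=1$. Assume: (i) for all $t,t'\in\Delta^+$ with $t'=\boldsymbol\mu t$, one has $\boldsymbol\mu^*\mathcal Z(t')=\mathcal Z(t)$; (ii) if $p^*n'=p^*n+u$ for some $u\in M^\circ_{\mathrm f}(t)$, then $F_{n'}(t)=F_n(t)$; and if $t,t'\in\Delta^+$ are similar up to $\sigma$ and $\mathrm{pr}_{I_{\mathrm{uf}}}B(t')n'=\sigma\,\mathrm{pr}_{I_{\mathrm{uf}}}B(t)n$ for $n,n'\in\mathbb{Z}^I$, then $c_{\sigma e}(n';t')=c_e(n;t)$ for all $e$. Let $t\in\Delta^+$ and let $\mathrm{tw}^X$ be any twist endomorphism on $\mathcal U^X=\mathcal U^X(t)$. Then: (1) $\mathrm{tw}^X\mathcal Z(t)\subset\mathcal Z(t)$. (2) If $\mathrm{tw}^X$ is a twist automorphism, then $\mathrm{tw}^X\mathcal Z(t)=\mathcal Z(t)$.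
   Context: Seeds. Fix a finite set $I=I_{\mathrm{uf}}\sqcup I_{\mathrm f}$ (unfrozen, frozen) and integers $d_i>0$. A seed $t$ has indeterminates $(A_i)_{i\in I}$, $(X_i)_{i\in I}$ and an integer matrix $B(t)=(b_{ij})_{i,j\in I}$ with $\frac1{d_i}b_{ij}=-\frac1{d_j}b_{ji}$. $N(t)=\mathbb{Z}^I$ has basis $\mathbf e_i$, $\mathbf f_i=\frac1{d_i}\mathbf e_i^*$, $M^\circ(t)=\bigoplus_i\mathbb{Z}\mathbf f_i\simeq\mathbb{Z}^I$, $M^\circ_{\mathrm f}(t)=\bigoplus_{j\in I_{\mathrm f}}\mathbb{Z}\mathbf f_j$. $p^*:N(t)\to M^\circ(t)$, $p^*\mathbf e_j=\sum_ib_{ij}\mathbf f_i$ (i.e. $n\mapsto B(t)n$ in coordinates). $\omega$ is the skew form on $N(t)$ with $\omega(\mathbf e_i,\mathbf e_j)=\frac1{d_j}b_{ji}$. $\mathrm{pr}_{I_{\mathrm{uf}}}:\mathbb{Z}^I\to\mathbb{Z}^{I_{\mathrm{uf}}}$ is the projection; for a permutation $\sigma$ of $I_{\mathrm{uf}}$ and a vector $w$, $(\sigma w)_{\sigma k}=w_k$. Objects of $t'$ carry a prime. Base ring. Classical case: $\Bbbk=\mathbb{Z}$, $v=1$. Quantum case: $\Bbbk=\mathbb{Z}[v^{\pm1/d'}]$, $d'$ sufficiently divisible. $\mathcal{LP}^X(t)=\Bbbk[X_i^{\pm1}]$ has product $X^n*X^{n'}=v^{-\omega(n,n')}X^{n+n'}$;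 $\cdot$ is the commutative product; $\mathcal F^X(t)$ is the (skew-)field of fractions. Mutation. For $k\in I_{\mathrm{uf}}$, $\mu_kt$ has matrix $b'_{ij}=-b_{ij}$ if $k\in\{i,j\}$, $b'_{ij}=b_{ij}+b_{ik}[b_{kj}]_++[-b_{ik}]_+b_{kj}$ otherwise ($[x]_+=\max(x,0)$). $\mu_k^*:\mathcal F^X(\mu_kt)\to\mathcal F^X(t)$ is $X'_k\mapsto X_k^{-1}$ and, for $i\ne k$, $X_i'\mapsto\sum_{s=0}^{-b_{ki}}\binom{-b_{ki}}{s}_{v_k}X_i\cdot X_k^s$ if $b_{ki}\le0$, $X'_i\mapsto\big(\sum_{s=0}^{b_{ki}}\binom{b_{ki}}{s}_{v_k}X_i^{-1}\cdot X_k^{s-b_{ki}}\big)^{-1}$ if $b_{ki}>0$, where $v_k=v^{1/d_k}$ and $\binom ab_q$ is the symmetric quantum binomial built from $[a]_q=\frac{q^a-q^{-a}}{q-q^{-1}}$ (ordinary binomial if $v=1$). For $\boldsymbol\mu=\mu_{k_l}\cdots\mu_{k_1}$: $\boldsymbol\mu^*=\mu_{k_1}^*\cdots\mu_{k_l}^*$. $\mathcal U^X(t)=\bigcap_{\boldsymbol\nu}\boldsymbol\nu^*\mathcal{LP}^X(\boldsymbol\nu t)\subset\mathcal F^X(t)$ over all mutation sequences; these are identified for different $t$ by mutations. Similar up to $\sigma$: $b_{ij}(t)=b_{\sigma i,\sigma j}(t')$, $d_i=d_{\sigma i}$ for $i,j\in I_{\mathrm{uf}}$. Twist endomorphisms.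 For $t'=\boldsymbol\mu t$ similar to $t$ up to $\sigma$, a (monomial) variation map from $t$ to $t'$ is a $\Bbbk$-algebra homomorphism (for $*$) $\mathrm{var}^X_t:\mathcal{LP}^X(t)\to\mathcal{LP}^X(t')$ of the form $X^n\mapsto(X')^{\mathrm{var}^N_tn}$ for a linear map $\mathrm{var}^N_t:N(t)\to N(t')$ with $\mathrm{var}^N_t(\mathbf e_k)=\mathbf e'_{\sigma k}$ and $\omega(\mathrm{var}^N_t\mathbf e_i,\mathrm{var}^N_t\mathbf e_k)=\omega(\mathbf e_i,\mathbf e_k)$ for all $i\in I$, $k\in I_{\mathrm{uf}}$ (the last condition is equivalent to $\mathrm{pr}_{I_{\mathrm{uf}}}B(t')\mathrm{var}^N_t(n)=\sigma\,\mathrm{pr}_{I_{\mathrm{uf}}}B(t)n$ for all $n$). It restricts to $\mathcal U^X(t)\to\mathcal U^X(t')$. A twist endomorphism on $\mathcal U^X(t)$ is a composition $\boldsymbol\mu^*\circ\mathrm{var}^X_t$ for some such $t'=\boldsymbol\mu t$, $\sigma$, $\mathrm{var}^X_t$; it is a twist automorphism if $\mathrm{var}^X_t$ is invertible. *)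

theory Defs
  imports
    "HOL-Analysis.Finite_Cartesian_Product"
    "HOL-Algebra.Ring"
    "HOL-Combinatorics.Permutations"
    "HOL-Library.Poly_Mapping"
begin

section \<open>Ring of right fractions of an Ore domain\<close>

text \<open>A pair \<open>(a, s)\<close> with \<open>s \<noteq> 0\<close> represents \<open>a s\<^sup>-\<^sup>1\<close>.  The operations are written as unions
  over all representatives; when the ring is an Ore domain all members of such a union are the
  same equivalence class.\<close>

definition ore_pairs :: "('a, 'm) ring_scheme \<Rightarrow> ('a \<times> 'a) set" where
  "ore_pairs R = carrier R \<times> (carrier R - {\<zero>\<^bsub>R\<^esub>})"

definition ore_rel :: "('a, 'm) ring_scheme \<Rightarrow> (('a \<times> 'a) \<times> ('a \<times> 'a)) set" where
  "ore_rel R = {((a, s), (b, t)). (a, s) \<in> ore_pairs R \<and> (b, t) \<in> ore_pairs R \<and>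
     (\<exists>c\<in>carrier R. \<exists>e\<in>carrier R. s \<otimes>\<^bsub>R\<^esub> c = t \<otimes>\<^bsub>R\<^esub> e \<and> s \<otimes>\<^bsub>R\<^esub> c \<noteq> \<zero>\<^bsub>R\<^esub> \<and> a \<otimes>\<^bsub>R\<^esub> c = b \<otimes>\<^bsub>R\<^esub> e)}"

definition ore_frac :: "('a, 'm) ring_scheme \<Rightarrow> 'a \<Rightarrow> 'a \<Rightarrow> ('a \<times> 'a) set" where
  "ore_frac R a s = ore_rel R `` {(a, s)}"

text \<open>Product: \<open>s\<^sup>-\<^sup>1 b = c u\<^sup>-\<^sup>1\<close> whenever \<open>b u = s c\<close>, so \<open>a s\<^sup>-\<^sup>1 b t\<^sup>-\<^sup>1 = (a c) (t u)\<^sup>-\<^sup>1\<close>.\<close>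

definition ore_mult :: "('a, 'm) ring_scheme \<Rightarrow> ('a \<times> 'a) set \<Rightarrow> ('a \<times> 'a) set \<Rightarrow> ('a \<times> 'a) set" where
  "ore_mult R P Q = \<Union>{ore_frac R (a \<otimes>\<^bsub>R\<^esub> c) (t \<otimes>\<^bsub>R\<^esub> u) | a s b t c u.
     (a, s) \<in> P \<and> (b, t) \<in> Q \<and> (c, u) \<in> ore_pairs R \<and> b \<otimes>\<^bsub>R\<^esub> u = s \<otimes>\<^bsub>R\<^esub> c}"

definition ore_add :: "('a, 'm) ring_scheme \<Rightarrow> ('a \<times> 'a) set \<Rightarrow> ('a \<times> 'a) set \<Rightarrow> ('a \<times> 'a) set" where
  "ore_add R P Q = \<Union>{ore_frac R (a \<otimes>\<^bsub>R\<^esub> c \<oplus>\<^bsub>R\<^esub> b \<otimes>\<^bsub>R\<^esub> e) (s \<otimes>\<^bsub>R\<^esub> c) | a s b t c e.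
     (a, s) \<in> P \<and> (b, t) \<in> Q \<and> c \<in> carrier R \<and> e \<in> carrier R \<and>
     s \<otimes>\<^bsub>R\<^esub> c = t \<otimes>\<^bsub>R\<^esub> e \<and> s \<otimes>\<^bsub>R\<^esub> c \<noteq> \<zero>\<^bsub>R\<^esub>}"

definition ore_ring :: "('a, 'm) ring_scheme \<Rightarrow> ('a \<times> 'a) set ring" where
  "ore_ring R = \<lparr>carrier = ore_pairs R // ore_rel R, monoid.mult = ore_mult R,
     one = ore_frac R \<one>\<^bsub>R\<^esub> \<one>\<^bsub>R\<^esub>, zero = ore_frac R \<zero>\<^bsub>R\<^esub> \<one>\<^bsub>R\<^esub>, add = ore_add R\<rparr>"


section \<open>Fixed data and base ring\<close>

text \<open>The index set is the finite type \<open>'i\<close>; the frozen vertices are those outside \<open>unfrozen\<close>.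
  \<open>vpw m\<close> is the element \<open>v\<^sup>m\<^sup>/\<^sup>d\<^sup>'\<close> of the base ring \<open>'k\<close>, where \<open>d'\<close> is \<open>denom\<close>.\<close>

record ('i, 'k) cluster_data =
  unfrozen :: "'i set"
  wt :: "'i \<Rightarrow> int"
  denom :: int
  vpw :: "int \<Rightarrow> 'k"

definition classical_base :: "(int \<Rightarrow> 'k::idom) \<Rightarrow> bool" where
  "classical_base V \<longleftrightarrow> bij (of_int :: int \<Rightarrow> 'k) \<and> (\<forall>m. V m = 1)"

text \<open>The base ring is \<open>\<int>[v\<^sup>\<plusminus>\<^sup>1\<^sup>/\<^sup>d\<^sup>']\<close>: the powers of \<open>v\<^sup>1\<^sup>/\<^sup>d\<^sup>'\<close> form a \<open>\<int>\<close>-basis.\<close>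

definition quantum_base :: "(int \<Rightarrow> 'k::idom) \<Rightarrow> bool" where
  "quantum_base V \<longleftrightarrow> V 0 = 1 \<and> (\<forall>m n. V (m + n) = V m * V n) \<and>
     bij (\<lambda>f :: int \<Rightarrow>\<^sub>0 int. \<Sum>m\<in>Poly_Mapping.keys f. of_int (Poly_Mapping.lookup f m) * V m)"

lemma classical_base_int: "classical_base (\<lambda>_. 1 :: int)"
  by (simp add: classical_base_def)

lemma quantum_base_Laurent: "quantum_base (\<lambda>m. Poly_Mapping.single m (1 :: int))"
proof -
  have "(\<Sum>m\<in>Poly_Mapping.keys f. of_int (Poly_Mapping.lookup f m) * Poly_Mapping.single m (1 :: int)) = f"
    for f :: "int \<Rightarrow>\<^sub>0 int"
  proof (rule poly_mapping_eqI)
    fix k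
    have *: "of_int c * Poly_Mapping.single m (1 :: int) = Poly_Mapping.single m c" for c m :: int
      by (simp add: single_of_int[symmetric] mult_single)
    show "Poly_Mapping.lookup (\<Sum>m\<in>Poly_Mapping.keys f. of_int (Poly_Mapping.lookup f m) * Poly_Mapping.single m (1 :: int)) k = Poly_Mapping.lookup f k"
      by (simp add: * lookup_sum lookup_single when_def sum.delta not_in_keys_iff_lookup_eq_zero)
  qed
  then have "(\<lambda>f :: int \<Rightarrow>\<^sub>0 int. \<Sum>m\<in>Poly_Mapping.keys f. of_int (Poly_Mapping.lookup f m) * Poly_Mapping.single m (1 :: int)) = id"
    by (simp add: fun_eq_iff)
  then show ?thesis
    by (simp add: quantum_base_def mult_single)
qed

definition cluster_setting :: "('i::finite, 'k::idom) cluster_data \<Rightarrow> bool" where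
  "cluster_setting D \<longleftrightarrow> (\<forall>i. wt D i > 0) \<and> 
     (classical_base (vpw D) \<or>
      quantum_base (vpw D) \<and> denom D > 0 \<and> (\<forall>i. wt D i dvd denom D))"

text \<open>\<open>v\<^sup>r\<close>, meaningful for \<open>r\<close> in \<open>(1/d') \<int>\<close>.\<close>

definition vpow :: "('i, 'k) cluster_data \<Rightarrow> rat \<Rightarrow> 'k" where
  "vpow D r = vpw D \<lfloor>of_int (denom D) * r\<rfloor>"

text \<open>For \<open>q m\<close> the \<open>m\<close>-th power of an invertible element \<open>q\<close>, this is
  \<open>[a]\<^sub>q = (q\<^sup>a - q\<^sup>-\<^sup>a) / (q - q\<^sup>-\<^sup>1)\<close> written as a sum, so that it also makes sense (and equals \<open>a\<close>)
  at \<open>q = 1\<close>.\<close>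

definition qnum :: "(int \<Rightarrow> 'k::idom) \<Rightarrow> nat \<Rightarrow> 'k" where
  "qnum q a = (\<Sum>s<a. q (int a - 1 - 2 * int s))"

lemma qnum_quotient:
  assumes "\<And>m n. q (m + n) = q m * q n"
  shows "qnum q a * (q 1 - q (-1)) = q (int a) - q (- int a)"
proof -
  have "qnum q a * (q 1 - q (-1)) =
      (\<Sum>s<a. q (int a - 2 * int s) - q (int a - 2 * int (Suc s)))"
    unfolding qnum_def sum_distrib_right
    by (rule sum.cong[OF refl])
      (simp add: right_diff_distrib assms[symmetric] algebra_simps)
  also have "\<dots> = q (int a) - q (- int a)"
    by (subst sum_lessThan_telescope') simp
  finally show ?thesis .
qed

definition qfact :: "(int \<Rightarrow> 'k::idom) \<Rightarrow> nat \<Rightarrow> 'k" where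
  "qfact q a = (\<Prod>j=1..a. qnum q j)"

text \<open>The symmetric quantum binomial lies in \<open>\<int>[q\<^sup>\<plusminus>\<^sup>1]\<close>, and the quotient of quantum factorials is
  taken there.\<close>

definition qbinom :: "(int \<Rightarrow> 'k::idom) \<Rightarrow> nat \<Rightarrow> nat \<Rightarrow> 'k" where
  "qbinom q a b = (THE x. x * (qfact q b * qfact q (a - b)) = qfact q a)"


section \<open>Exchange matrices and the quantum torus\<close>

text \<open>Only the exchange matrix of a seed enters the constructions below.  An element of
  \<open>\<L>\<P>\<^sup>X\<close> is a finitely supported map from exponents to coefficients: \<open>single n 1\<close> is \<open>X\<^sup>n\<close>, and
  the convolution product \<open>*\<close> of \<open>HOL-Library.Poly_Mapping\<close> is the commutative product.\<close>

type_synonym ('i, 'k) torus = "(int ^ 'i) \<Rightarrow>\<^sub>0 'k"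

definition exchange_matrix :: "('i::finite, 'k) cluster_data \<Rightarrow> int ^ 'i ^ 'i \<Rightarrow> bool" where
  "exchange_matrix D B \<longleftrightarrow>
     (\<forall>i j. rat_of_int (B $ i $ j) / rat_of_int (wt D i) = - (rat_of_int (B $ j $ i) / rat_of_int (wt D j)))"

definition mut_matrix :: "'i::finite \<Rightarrow> int ^ 'i ^ 'i \<Rightarrow> int ^ 'i ^ 'i" where
  "mut_matrix k B = (\<chi> i j. if i = k \<or> j = k then - B $ i $ j
     else B $ i $ j + B $ i $ k * max (B $ k $ j) 0 + max (- B $ i $ k) 0 * B $ k $ j)"

definition pstar :: "int ^ 'i ^ 'i \<Rightarrow> int ^ 'i \<Rightarrow> int ^ 'i::finite" where
  "pstar B n = B *v n"

definition omega :: "('i::finite, 'k) cluster_data \<Rightarrow> int ^ 'i ^ 'i \<Rightarrow> int ^ 'i \<Rightarrow> int ^ 'i \<Rightarrow> rat" where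
  "omega D B m n = (\<Sum>i\<in>UNIV. \<Sum>j\<in>UNIV.
     rat_of_int (m $ i) * rat_of_int (n $ j) * (rat_of_int (B $ j $ i) / rat_of_int (wt D j)))"

definition torus_mult ::
  "('i::finite, 'k::idom) cluster_data \<Rightarrow> int ^ 'i ^ 'i \<Rightarrow> ('i, 'k) torus \<Rightarrow> ('i, 'k) torus \<Rightarrow> ('i, 'k) torus" where
  "torus_mult D B f g = (\<Sum>m\<in>Poly_Mapping.keys f. \<Sum>n\<in>Poly_Mapping.keys g.
     Poly_Mapping.single (m + n) (Poly_Mapping.lookup f m * Poly_Mapping.lookup g n * vpow D (- omega D B m n)))"

definition LPX :: "('i::finite, 'k::idom) cluster_data \<Rightarrow> int ^ 'i ^ 'i \<Rightarrow> ('i, 'k) torus ring" where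
  "LPX D B = \<lparr>carrier = UNIV, monoid.mult = torus_mult D B, one = 1, zero = 0, add = (+)\<rparr>"

type_synonym ('i, 'k) torus_frac = "(('i, 'k) torus \<times> ('i, 'k) torus) set"

definition FX :: "('i::finite, 'k::idom) cluster_data \<Rightarrow> int ^ 'i ^ 'i \<Rightarrow> ('i, 'k) torus_frac ring" where
  "FX D B = ore_ring (LPX D B)"

definition emb ::
  "('i::finite, 'k::idom) cluster_data \<Rightarrow> int ^ 'i ^ 'i \<Rightarrow> ('i, 'k) torus \<Rightarrow> ('i, 'k) torus_frac" where
  "emb D B f = ore_frac (LPX D B) f 1"


section \<open>Mutations\<close>

text \<open>\<open>vk m\<close> is \<open>v\<^sub>k\<^sup>m = v\<^sup>m\<^sup>/\<^sup>d\<^sub>k\<close>.\<close>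

definition mut_gen ::
  "('i::finite, 'k::idom) cluster_data \<Rightarrow> 'i \<Rightarrow> int ^ 'i ^ 'i \<Rightarrow> 'i \<Rightarrow> ('i, 'k) torus_frac" where
  "mut_gen D k B i =
    (let b = B $ k $ i; vk = (\<lambda>m. vpow D (rat_of_int m / rat_of_int (wt D k))) in
     if i = k then emb D B (Poly_Mapping.single (- axis k 1) 1)
     else if b \<le> 0 then
       emb D B (\<Sum>s\<le>nat (- b). Poly_Mapping.single (axis i 1 + axis k (int s)) (qbinom vk (nat (- b)) s))
     else m_inv (FX D B)
       (emb D B (\<Sum>s\<le>nat b. Poly_Mapping.single (- axis i 1 + axis k (int s - b)) (qbinom vk (nat b) s))))"

text \<open>The homomorphism \<open>\<mu>\<^sub>k\<^sup>*\<close> of (skew-)fields over the base ring is determined by the images of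
  the generators.\<close>

definition mut_hom ::
  "('i::finite, 'k::idom) cluster_data \<Rightarrow> 'i \<Rightarrow> int ^ 'i ^ 'i \<Rightarrow> ('i, 'k) torus_frac \<Rightarrow> ('i, 'k) torus_frac" where
  "mut_hom D k B = (THE \<phi>.
     \<phi> \<in> ring_hom (FX D (mut_matrix k B)) (FX D B) \<and>
     \<phi> \<in> extensional (carrier (FX D (mut_matrix k B))) \<and>
     (\<forall>a. \<phi> (emb D (mut_matrix k B) (Poly_Mapping.single 0 a)) = emb D B (Poly_Mapping.single 0 a)) \<and>
     (\<forall>i. \<phi> (emb D (mut_matrix k B) (Poly_Mapping.single (axis i 1) 1)) = mut_gen D k B i))"

text \<open>The list \<open>[k\<^sub>1, \<dots>, k\<^sub>l]\<close> stands for the mutation sequence \<open>\<mu>\<^sub>k\<^sub>l \<cdots> \<mu>\<^sub>k\<^sub>1\<close>.\<close>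

primrec mut_seq_hom ::
  "('i::finite, 'k::idom) cluster_data \<Rightarrow> 'i list \<Rightarrow> int ^ 'i ^ 'i \<Rightarrow> ('i, 'k) torus_frac \<Rightarrow> ('i, 'k) torus_frac" where
  "mut_seq_hom D [] B = (\<lambda>x. x)"
| "mut_seq_hom D (k # ks) B = mut_hom D k B \<circ> mut_seq_hom D ks (mut_matrix k B)"

definition UX :: "('i::finite, 'k::idom) cluster_data \<Rightarrow> int ^ 'i ^ 'i \<Rightarrow> ('i, 'k) torus_frac set" where
  "UX D B = (\<Inter>ks\<in>lists (unfrozen D).
     mut_seq_hom D ks B ` emb D (fold mut_matrix ks B) ` carrier (LPX D (fold mut_matrix ks B)))"

text \<open>The type \<open>'s\<close> is the type of seeds; nothing is fixed about when different mutation sequences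
  lead to the same seed, beyond the behaviour of the exchange matrices.\<close>

definition seed_structure ::
  "('i::finite, 'k::idom) cluster_data \<Rightarrow> ('i \<Rightarrow> 's \<Rightarrow> 's) \<Rightarrow> ('s \<Rightarrow> int ^ 'i ^ 'i) \<Rightarrow> bool" where
  "seed_structure D mu B \<longleftrightarrow> (\<forall>t. exchange_matrix D (B t)) \<and>
     (\<forall>t. \<forall>k\<in>unfrozen D. B (mu k t) = mut_matrix k (B t))"

definition Delta_plus :: "('i, 'k) cluster_data \<Rightarrow> ('i \<Rightarrow> 's \<Rightarrow> 's) \<Rightarrow> 's \<Rightarrow> 's set" where
  "Delta_plus D mu t0 = {fold mu ks t0 | ks. ks \<in> lists (unfrozen D)}"


section \<open>Similar seeds and twist endomorphisms\<close>

definition pr_uf :: "('i::finite, 'k) cluster_data \<Rightarrow> int ^ 'i \<Rightarrow> int ^ 'i" where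
  "pr_uf D w = (\<chi> i. if i \<in> unfrozen D then w $ i else 0)"

definition perm_act :: "('i \<Rightarrow> 'i) \<Rightarrow> int ^ 'i \<Rightarrow> int ^ 'i::finite" where
  "perm_act \<sigma> w = (\<chi> i. w $ inv_into UNIV \<sigma> i)"

lemma perm_act_nth: "\<sigma> permutes S \<Longrightarrow> perm_act \<sigma> w $ \<sigma> k = w $ k"
  by (simp add: perm_act_def permutes_inverses)

text \<open>The set \<open>\<nat>\<^sup>I\<^sup>u\<^sup>f\<close>, as a subset of \<open>\<int>\<^sup>I\<close>.\<close>

definition uf_exps :: "('i::finite, 'k) cluster_data \<Rightarrow> (int ^ 'i) set" where
  "uf_exps D = {e. (\<forall>i\<in>unfrozen D. e $ i \<ge> 0) \<and> (\<forall>i. i \<notin> unfrozen D \<longrightarrow> e $ i = 0)}"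

text \<open>\<open>\<sigma>\<close> is a permutation of the unfrozen vertices, extended by the identity to all vertices.\<close>

definition similar ::
  "('i::finite, 'k) cluster_data \<Rightarrow> ('i \<Rightarrow> 'i) \<Rightarrow> int ^ 'i ^ 'i \<Rightarrow> int ^ 'i ^ 'i \<Rightarrow> bool" where
  "similar D \<sigma> B B' \<longleftrightarrow> \<sigma> permutes unfrozen D \<and>
     (\<forall>i\<in>unfrozen D. \<forall>j\<in>unfrozen D. B $ i $ j = B' $ \<sigma> i $ \<sigma> j) \<and>
     (\<forall>i\<in>unfrozen D. wt D i = wt D (\<sigma> i))"

text \<open>Multiplying by \<open>single 0 a\<close> in the commutative product is multiplication by the scalar \<open>a\<close>.\<close>

definition variation_map ::
  "('i::finite, 'k::idom) cluster_data \<Rightarrow> ('i \<Rightarrow> 'i) \<Rightarrow> int ^ 'i ^ 'i \<Rightarrow> int ^ 'i ^ 'i \<Rightarrow>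
     (('i, 'k) torus \<Rightarrow> ('i, 'k) torus) \<Rightarrow> bool" where
  "variation_map D \<sigma> B B' varX \<longleftrightarrow>
     varX \<in> ring_hom (LPX D B) (LPX D B') \<and>
     (\<forall>a f. varX (Poly_Mapping.single 0 a * f) = Poly_Mapping.single 0 a * varX f) \<and>
     (\<exists>varN :: int ^ 'i \<Rightarrow> int ^ 'i. additive varN \<and>
        (\<forall>n. varX (Poly_Mapping.single n 1) = Poly_Mapping.single (varN n) 1) \<and>
        (\<forall>k\<in>unfrozen D. varN (axis k 1) = axis (\<sigma> k) 1) \<and>
        (\<forall>i. \<forall>k\<in>unfrozen D.
           omega D B' (varN (axis i 1)) (varN (axis k 1)) = omega D B (axis i 1) (axis k 1)))"

text \<open>On \<open>\<U>\<^sup>X(t) \<subseteq> \<L>\<P>\<^sup>X(t)\<close> the map \<open>tw\<close> is \<open>\<mu>\<^sup>* \<circ> var\<^sup>X\<close>; its values elsewhere are irrelevant.\<close>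

definition twist_via ::
  "('i::finite, 'k::idom) cluster_data \<Rightarrow> int ^ 'i ^ 'i \<Rightarrow> 'i list \<Rightarrow> ('i \<Rightarrow> 'i) \<Rightarrow>
     (('i, 'k) torus \<Rightarrow> ('i, 'k) torus) \<Rightarrow> (('i, 'k) torus_frac \<Rightarrow> ('i, 'k) torus_frac) \<Rightarrow> bool" where
  "twist_via D B ks \<sigma> varX tw \<longleftrightarrow>
     ks \<in> lists (unfrozen D) \<and>
     similar D \<sigma> B (fold mut_matrix ks B) \<and>
     variation_map D \<sigma> B (fold mut_matrix ks B) varX \<and>
     (\<forall>f. emb D B f \<in> UX D B \<longrightarrow>
        tw (emb D B f) = mut_seq_hom D ks B (emb D (fold mut_matrix ks B) (varX f)))"

definition twist_endomorphism ::
  "('i::finite, 'k::idom) cluster_data \<Rightarrow> int ^ 'i ^ 'i \<Rightarrow>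
     (('i, 'k) torus_frac \<Rightarrow> ('i, 'k) torus_frac) \<Rightarrow> bool" where
  "twist_endomorphism D B tw \<longleftrightarrow> (\<exists>ks \<sigma> varX. twist_via D B ks \<sigma> varX tw)"

definition twist_automorphism ::
  "('i::finite, 'k::idom) cluster_data \<Rightarrow> int ^ 'i ^ 'i \<Rightarrow>
     (('i, 'k) torus_frac \<Rightarrow> ('i, 'k) torus_frac) \<Rightarrow> bool" where
  "twist_automorphism D B tw \<longleftrightarrow> (\<exists>ks \<sigma> varX. twist_via D B ks \<sigma> varX tw \<and> bij varX)"

end

theory Submission
  imports Defs
begin

text \<open>A variation map sends the monomial \<open>X\<^sup>n\<close> to \<open>X'\<^sup>m\<close> with \<open>m = var\<^sup>N n\<close>, and on exponents
  supported on the unfrozen vertices it is just the permutation \<open>\<sigma>\<close>.  Its compatibility with \<open>\<omega>\<close> says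
  that \<open>m\<close> and \<open>n\<close> satisfy the hypothesis of (ii), so it maps \<open>Z\<^sub>n(t)\<close> to \<open>Z\<^sub>m(t')\<close>.  By (i), the
  mutation map takes the latter back into \<open>\<Z>(t)\<close>.  If \<open>var\<^sup>X\<close> is bijective, then \<open>var\<^sup>N\<close> is onto,
  so every \<open>Z\<^sub>m(t')\<close> is reached.\<close>

section \<open>Additive maps on integer vectors\<close>

lemma additive_int_zero:
  fixes h :: "int \<Rightarrow> 'a::ab_group_add"
  assumes "additive h" and "h 1 = 0"
  shows "h c = 0"
proof (induction c rule: int_induct[where k = 0])
  case base
  show ?case using additive.zero[OF assms(1)] .
next
  case (step1 i)
  then show ?case using additive.add[OF assms(1), of i 1] assms(2) by simp
next
  case (step2 i)
  then show ?case using additive.diff[OF assms(1), of i 1] assms(2) by simp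
qed

text \<open>An integer vector is a sum of integer multiples of basis vectors, so additivity alone
  determines the values. The set \<open>S\<close> allows two uses: agreement on all of \<int>^I, or
  only on vectors supported on the unfrozen vertices.\<close>

lemma additive_vec_eqI:
  fixes f g :: "int ^ 'i::finite \<Rightarrow> 'a::ab_group_add"
  assumes f: "additive f" and g: "additive g"
    and eq: "\<And>i. i \<in> S \<Longrightarrow> f (axis i 1) = g (axis i 1)"
    and supp: "\<And>i. i \<notin> S \<Longrightarrow> n $ i = 0"
  shows "f n = g n"
proof -
  \<comment> \<open>Passing to the difference reduces the claim to vanishing on each coordinate
    axis, where \<open>additive_int_zero\<close> applies.\<close>
  define h where "h x = f x - g x" for x
  have h: "additive h"
    by unfold_locales (simp add: h_def additive.add[OF f] additive.add[OF g])
  have n: "n = (\<Sum>i\<in>UNIV. axis i (n $ i))"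
    by (simp add: vec_eq_iff axis_def)
  have axis_zero: "axis i 0 = (0 :: int ^ 'i)" for i
    by (simp add: vec_eq_iff axis_def)
  have "h (axis i (n $ i)) = 0" for i
  proof (cases "i \<in> S")
    case True
    have "additive (\<lambda>c. h (axis i c))"
    proof unfold_locales
      fix x y :: int
      have "axis i (x + y) = axis i x + axis i y"
        by (simp add: vec_eq_iff axis_def)
      then show "h (axis i (x + y)) = h (axis i x) + h (axis i y)"
        by (simp add: additive.add[OF h])
    qed
    then show ?thesis
      by (rule additive_int_zero) (simp add: h_def eq[OF True])
  next
    case False
    then show ?thesis using additive.zero[OF h] by (simp add: supp axis_zero)
  qed
  then have "h n = 0"
    by (subst n) (simp add: additive.sum[OF h])
  then show ?thesis by (simp add: h_def)
qed

lemma additive_perm_act: "additive (perm_act \<sigma>)"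
  by unfold_locales (simp add: perm_act_def vec_eq_iff)

lemma perm_act_axis:
  assumes "\<sigma> permutes S"
  shows "perm_act \<sigma> (axis k 1) = axis (\<sigma> k) 1"
  using assms by (auto simp: perm_act_def axis_def vec_eq_iff permutes_inverses)

lemma perm_act_inverse:
  assumes "\<sigma> permutes S"
  shows "perm_act \<sigma> (perm_act (inv_into UNIV \<sigma>) w) = w" and "perm_act (inv_into UNIV \<sigma>) (perm_act \<sigma> w) = w"
  using assms
  by (simp_all add: perm_act_def vec_eq_iff permutes_inverses permutes_inv_inv)

lemma perm_act_uf_exps:
  assumes "\<sigma> permutes unfrozen D" and "e \<in> uf_exps D"
  shows "perm_act \<sigma> e \<in> uf_exps D"
proof -
  have "inv_into UNIV \<sigma> i \<in> unfrozen D \<longleftrightarrow> i \<in> unfrozen D" for i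
    using permutes_in_image[OF permutes_inv[OF assms(1)]] .
  then show ?thesis
    using assms(2) by (simp add: uf_exps_def perm_act_def)
qed


section \<open>Variation maps\<close>

text \<open>Pairing with a basis vector reads off one row of the exchange matrix. This turns the
  condition on \<omega> in a variation map into a statement about rows of \<open>B\<close>.\<close>

lemma omega_axis_right:
  "omega D B m (axis k 1) = of_int ((B *v m) $ k) / of_int (wt D k)"
proof -
  have "omega D B m (axis k 1) = (\<Sum>i\<in>UNIV. \<Sum>j\<in>UNIV.
      if j = k then of_int (m $ i) * (of_int (B $ k $ i) / of_int (wt D k)) else 0)"
    unfolding omega_def by (intro sum.cong refl) (auto simp: axis_def)
  also have "\<dots> = of_int ((B *v m) $ k) / of_int (wt D k)"
    by (simp add: matrix_vector_mult_def sum_divide_distrib mult.commute)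
  finally show ?thesis .
qed

text \<open>Both sides are additive in \<open>n\<close>, so comparing row \<sigma> k of
  \<open>B'\<close> with row k of \<open>B\<close> on basis vectors suffices. There the invariance
  of \<open>omega\<close> gives equality up to the denominators \<open>wt D (\<sigma> k)\<close> and
  \<open>wt D k\<close>, which coincide by similarity. The conclusion has the form required by
  hypothesis (ii).\<close>

lemma variation_exponent_mult:
  fixes D :: "('i::finite, 'k) cluster_data"
  assumes wt: "\<And>i. wt D i > 0" and sim: "similar D \<sigma> B B'" and add: "additive varN"
    and basis: "\<And>k. k \<in> unfrozen D \<Longrightarrow> varN (axis k 1) = axis (\<sigma> k) 1"
    and om: "\<And>i k. k \<in> unfrozen D \<Longrightarrow>
      omega D B' (varN (axis i 1)) (varN (axis k 1)) = omega D B (axis i 1) (axis k 1)"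
  shows "pr_uf D (B' *v varN n) = perm_act \<sigma> (pr_uf D (B *v n))"
proof -
  have perm: "\<sigma> permutes unfrozen D"
    and wt_perm: "\<And>i. i \<in> unfrozen D \<Longrightarrow> wt D (\<sigma> i) = wt D i"
    using sim by (auto simp: similar_def)
  have row: "(B' *v varN n) $ \<sigma> k = (B *v n) $ k" if k: "k \<in> unfrozen D" for k
  proof (rule additive_vec_eqI[where S = UNIV and f = "\<lambda>n. (B' *v varN n) $ \<sigma> k"
        and g = "\<lambda>n. (B *v n) $ k"])
    show "additive (\<lambda>n. (B' *v varN n) $ \<sigma> k)"
      by unfold_locales
        (simp add: additive.add[OF add] matrix_vector_mult_def distrib_left sum.distrib)
    show "additive (\<lambda>n. (B *v n) $ k)"
      by unfold_locales (simp add: matrix_vector_mult_def distrib_left sum.distrib)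
    show "(B' *v varN (axis i 1)) $ \<sigma> k = (B *v axis i 1) $ k" for i
      using om[OF k, of i] wt[of k] by (simp add: basis[OF k] omega_axis_right wt_perm[OF k])
  qed simp
  show ?thesis
  proof (subst vec_eq_iff, rule allI)
    fix j
    show "pr_uf D (B' *v varN n) $ j = perm_act \<sigma> (pr_uf D (B *v n)) $ j"
    proof (cases "j \<in> unfrozen D")
      case True
      then have inv: "inv_into UNIV \<sigma> j \<in> unfrozen D"
        using permutes_in_image[OF permutes_inv[OF perm]] by blast
      show ?thesis
        using row[OF inv] True inv
        by (simp add: pr_uf_def perm_act_def permutes_inverses[OF perm])
    next
      case False
      then have "inv_into UNIV \<sigma> j \<notin> unfrozen D"
        using permutes_in_image[OF permutes_inv[OF perm]] by blast
      with False show ?thesis by (simp add: pr_uf_def perm_act_def)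
    qed
  qed
qed

lemma additive_LPX_hom:
  assumes "h \<in> ring_hom (LPX D B) (LPX D B')"
  shows "additive h"
  using ring_hom_add[OF assms] by unfold_locales (simp add: LPX_def)

lemma torus_eq_sum_monomials:
  fixes f :: "'a \<Rightarrow>\<^sub>0 'b::comm_monoid_add"
  shows "f = (\<Sum>k\<in>Poly_Mapping.keys f. Poly_Mapping.single k (Poly_Mapping.lookup f k))"
  by (rule poly_mapping_eqI)
    (simp add: lookup_sum lookup_single when_def not_in_keys_iff_lookup_eq_zero)

section \<open>Linear maps of the torus that send monomials to monomials\<close>

context
  fixes varX :: "('i::finite, 'k::idom) torus \<Rightarrow> ('i, 'k) torus" and varN
  assumes add: "additive varX"
    and scalar: "\<And>a f. varX (Poly_Mapping.single 0 a * f) = Poly_Mapping.single 0 a * varX f"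
    and monom: "\<And>n. varX (Poly_Mapping.single n 1) = Poly_Mapping.single (varN n) 1"
begin

lemma variation_single: "varX (Poly_Mapping.single n a) = Poly_Mapping.single (varN n) a"
  using scalar[of a "Poly_Mapping.single n 1"] by (simp add: monom mult_single)

lemma variation_expand:
  "varX f = (\<Sum>k\<in>Poly_Mapping.keys f. Poly_Mapping.single (varN k) (Poly_Mapping.lookup f k))"
  by (subst torus_eq_sum_monomials) (simp add: additive.sum[OF add] variation_single)

text \<open>The homomorphism property of a variation map concerns the twisted product
  \<open>torus_mult\<close>, whereas X^n and F_n are multiplied commutatively. Compatibility with
  the latter comes from expanding \<open>f\<close> into monomials and using additivity of
  \<open>varN\<close>.\<close>

lemma variation_monom_mult:
  assumes "additive varN"
  shows "varX (Poly_Mapping.single n 1 * f) = Poly_Mapping.single (varN n) 1 * varX f"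
proof -
  have "varX (Poly_Mapping.single n 1 * f) = (\<Sum>k\<in>Poly_Mapping.keys f.
      varX (Poly_Mapping.single n 1 * Poly_Mapping.single k (Poly_Mapping.lookup f k)))"
    by (subst torus_eq_sum_monomials[of f]) (simp add: sum_distrib_left additive.sum[OF add])
  also have "\<dots> = Poly_Mapping.single (varN n) 1 * varX f"
    by (simp add: variation_expand[of f] sum_distrib_left mult_single variation_single
        additive.add[OF assms])
  finally show ?thesis .
qed

text \<open>The support of any \<open>varX f\<close> lies in the range of \<open>varN\<close>, so a
  monomial with exponent outside that range cannot be attained.\<close>

lemma surj_variation_exponent:
  assumes "surj varX"
  shows "surj varN"
proof -
  have "m \<in> range varN" for m
  proof (rule ccontr)
    assume m: "m \<notin> range varN"
    obtain f where f: "varX f = Poly_Mapping.single m 1"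
      using assms by (metis surjD)
    have "Poly_Mapping.lookup (varX f) m = 0"
      using m by (auto simp: variation_expand lookup_sum lookup_single when_def intro!: sum.neutral)
    then show False by (simp add: f)
  qed
  then show ?thesis by blast
qed

text \<open>On \<open>uf_exps D\<close> the map \<open>varN\<close> agrees with the injective map
  \<open>perm_act \<sigma>\<close>. Hence \<open>varX\<close> relabels the exponents of
  \<open>f\<close> without merging terms, and coefficients can be compared one by one.\<close>

lemma variation_permuted_coeffs:
  assumes perm: "\<sigma> permutes unfrozen D" and addN: "additive varN"
    and basis: "\<And>k. k \<in> unfrozen D \<Longrightarrow> varN (axis k 1) = axis (\<sigma> k) 1"
    and keys: "Poly_Mapping.keys f \<subseteq> uf_exps D" "Poly_Mapping.keys g \<subseteq> uf_exps D"
    and coeff: "\<And>e. e \<in> uf_exps D \<Longrightarrow>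
      Poly_Mapping.lookup g (perm_act \<sigma> e) = Poly_Mapping.lookup f e"
  shows "varX f = g"
proof (rule poly_mapping_eqI)
  fix m
  have varN: "varN e = perm_act \<sigma> e" if "e \<in> uf_exps D" for e
    by (rule additive_vec_eqI[OF addN additive_perm_act, where S = "unfrozen D"])
      (use that in \<open>simp_all add: basis perm_act_axis[OF perm] uf_exps_def\<close>)
  \<comment> \<open>The only exponent that can contribute to the coefficient at
    \<open>m\<close>.\<close>
  define e where "e = perm_act (inv_into UNIV \<sigma>) m"
  have m: "m = perm_act \<sigma> e"
    by (simp add: e_def perm_act_inverse[OF perm])
  have "Poly_Mapping.lookup (varX f) m =
      (\<Sum>k\<in>Poly_Mapping.keys f. if k = e then Poly_Mapping.lookup f k else 0)"
    unfolding variation_expand lookup_sum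
  proof (rule sum.cong[OF refl])
    fix k assume "k \<in> Poly_Mapping.keys f"
    then have "varN k = perm_act \<sigma> k" using keys(1) varN by blast
    moreover have "perm_act \<sigma> k = m \<longleftrightarrow> k = e"
      unfolding m using perm_act_inverse(2)[OF perm] by metis
    ultimately show "Poly_Mapping.lookup
        (Poly_Mapping.single (varN k) (Poly_Mapping.lookup f k)) m =
        (if k = e then Poly_Mapping.lookup f k else 0)"
      by (simp add: lookup_single when_def)
  qed
  also have "\<dots> = Poly_Mapping.lookup f e"
    by (simp add: not_in_keys_iff_lookup_eq_zero)
  also have "\<dots> = Poly_Mapping.lookup g m"
  proof (cases "e \<in> uf_exps D")
    case True
    then show ?thesis by (simp add: m coeff)
  next
    case False
    \<comment> \<open>The inverse permutation also preserves \<open>uf_exps D\<close>, so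
      \<open>e\<close> and \<open>m\<close> both lie outside the supports and both coefficients are
      0.\<close>
    then have "m \<notin> uf_exps D"
      using perm_act_uf_exps[OF permutes_inv[OF perm]] by (auto simp: e_def)
    with False show ?thesis
      using keys by (metis in_keys_iff subsetD)
  qed
  finally show "Poly_Mapping.lookup (varX f) m = Poly_Mapping.lookup g m" .
qed

end


section \<open>Seeds\<close>

lemma Delta_plus_fold:
  assumes "t \<in> Delta_plus D mu t0" and "ks \<in> lists (unfrozen D)"
  shows "fold mu ks t \<in> Delta_plus D mu t0"
proof -
  obtain ks0 where "t = fold mu ks0 t0" "ks0 \<in> lists (unfrozen D)"
    using assms(1) by (auto simp: Delta_plus_def)
  then have "fold mu ks t = fold mu (ks0 @ ks) t0" "ks0 @ ks \<in> lists (unfrozen D)"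
    using assms(2) by auto
  then show ?thesis unfolding Delta_plus_def by blast
qed

text \<open>Twist maps are phrased through mutated matrices, while \<open>Z\<close> and
  \<open>F\<close> are indexed by seeds; this links the two.\<close>

lemma matrix_fold_mu:
  assumes "seed_structure D mu B" and "ks \<in> lists (unfrozen D)"
  shows "B (fold mu ks t) = fold mut_matrix ks (B t)"
  using assms(2)
proof (induction ks arbitrary: t)
  case (Cons k ks)
  then show ?case using assms(1) by (simp add: seed_structure_def)
qed simp

theorem theorem6p4:
  fixes D :: "('i::finite, 'k::idom) cluster_data"
    and mu :: "'i \<Rightarrow> 's \<Rightarrow> 's"
    and B :: "'s \<Rightarrow> int ^ 'i ^ 'i"
    and t0 t :: 's
    and F :: "'s \<Rightarrow> int ^ 'i \<Rightarrow> ('i, 'k) torus"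
    and Z :: "'s \<Rightarrow> ('i, 'k) torus set"
    and tw :: "('i, 'k) torus_frac \<Rightarrow> ('i, 'k) torus_frac"
  assumes setting: "cluster_setting D"
    and seeds: "seed_structure D mu B"
    and Z: "\<forall>t\<in>Delta_plus D mu t0. Z t = {Poly_Mapping.single n 1 * F t n | n. True}"
    and F_poly: "\<forall>t\<in>Delta_plus D mu t0. \<forall>n. Poly_Mapping.keys (F t n) \<subseteq> uf_exps D \<and> Poly_Mapping.lookup (F t n) 0 = 1"
    and i: "\<forall>t\<in>Delta_plus D mu t0. \<forall>t'\<in>Delta_plus D mu t0. \<forall>ks\<in>lists (unfrozen D).
       t' = fold mu ks t \<longrightarrow> mut_seq_hom D ks (B t) ` emb D (B t') ` Z t' = emb D (B t) ` Z t"
    and ii_frozen: "\<forall>t\<in>Delta_plus D mu t0. \<forall>n n' u. (\<forall>i\<in>unfrozen D. u $ i = 0) \<longrightarrow>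
       pstar (B t) n' = pstar (B t) n + u \<longrightarrow> F t n' = F t n"
    and ii_similar: "\<forall>t\<in>Delta_plus D mu t0. \<forall>t'\<in>Delta_plus D mu t0. \<forall>\<sigma>. similar D \<sigma> (B t) (B t') \<longrightarrow>
       (\<forall>n n'. pr_uf D (B t' *v n') = perm_act \<sigma> (pr_uf D (B t *v n)) \<longrightarrow>
          (\<forall>e\<in>uf_exps D. Poly_Mapping.lookup (F t' n') (perm_act \<sigma> e) = Poly_Mapping.lookup (F t n) e))"
    and t: "t \<in> Delta_plus D mu t0"
    and tw: "twist_endomorphism D (B t) tw"
  shows "tw ` emb D (B t) ` Z t \<subseteq> emb D (B t) ` Z t \<and>
    (twist_automorphism D (B t) tw \<longrightarrow> tw ` emb D (B t) ` Z t = emb D (B t) ` Z t)"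
proof -
  \<comment> \<open>Both claims are shown for an arbitrary presentation of \<open>tw\<close>: the
    one witnessing that it is an automorphism may differ from the one witnessing that it is an
    endomorphism.\<close>
  have main: "tw ` emb D (B t) ` Z t \<subseteq> emb D (B t) ` Z t \<and>
      (bij varX \<longrightarrow> tw ` emb D (B t) ` Z t = emb D (B t) ` Z t)"
    if via: "twist_via D (B t) ks \<sigma> varX tw" for ks \<sigma> varX
  proof -
    define t' where "t' = fold mu ks t"
    have ks: "ks \<in> lists (unfrozen D)"
      using via by (simp add: twist_via_def)
    have t': "t' \<in> Delta_plus D mu t0"
      unfolding t'_def by (rule Delta_plus_fold[OF t ks])
    have B': "fold mut_matrix ks (B t) = B t'"
      unfolding t'_def by (rule matrix_fold_mu[OF seeds ks, symmetric])
    have sim: "similar D \<sigma> (B t) (B t')" and var: "variation_map D \<sigma> (B t) (B t') varX"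
      using via by (simp_all add: twist_via_def B')
    have perm: "\<sigma> permutes unfrozen D" using sim by (simp add: similar_def)
    have addX: "additive varX"
      using var additive_LPX_hom by (auto simp: variation_map_def)
    have scalar: "varX (Poly_Mapping.single 0 a * f) = Poly_Mapping.single 0 a * varX f" for a f
      using var by (simp add: variation_map_def)
    obtain varN where addN: "additive varN"
      and monom: "\<And>n. varX (Poly_Mapping.single n 1) = Poly_Mapping.single (varN n) 1"
      and basis: "\<And>k. k \<in> unfrozen D \<Longrightarrow> varN (axis k 1) = axis (\<sigma> k) 1"
      and om: "\<And>i k. k \<in> unfrozen D \<Longrightarrow>
        omega D (B t') (varN (axis i 1)) (varN (axis k 1)) = omega D (B t) (axis i 1) (axis k 1)"
      using var unfolding variation_map_def by blast
    have wt: "wt D i > 0" for i using setting by (simp add: cluster_setting_def)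
    have "varX (F t n) = F t' (varN n)" for n
    proof (rule variation_permuted_coeffs[OF addX scalar monom perm addN basis])
      show "Poly_Mapping.keys (F t n) \<subseteq> uf_exps D" "Poly_Mapping.keys (F t' (varN n)) \<subseteq> uf_exps D"
        using F_poly t t' by blast+
      show "Poly_Mapping.lookup (F t' (varN n)) (perm_act \<sigma> e) = Poly_Mapping.lookup (F t n) e"
        if "e \<in> uf_exps D" for e
        using ii_similar t t' sim that variation_exponent_mult[OF wt sim addN basis om, of n]
        by blast
    qed
    then have varX_Z: "varX (Poly_Mapping.single n 1 * F t n) =
        Poly_Mapping.single (varN n) 1 * F t' (varN n)" for n
      by (simp add: variation_monom_mult[OF addX scalar monom addN])
    have Zt: "Z t = range (\<lambda>n. Poly_Mapping.single n 1 * F t n)"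
      and Zt': "Z t' = range (\<lambda>n. Poly_Mapping.single n 1 * F t' n)"
      using Z t t' by auto
    have image: "varX ` Z t = (\<lambda>n. Poly_Mapping.single n 1 * F t' n) ` range varN"
      by (simp add: Zt varX_Z image_image)
    \<comment> \<open>Hypothesis (i) is instantiated for every sequence, not just \<open>ks\<close>,
      because \<open>UX\<close> is an intersection over all of them.\<close>
    have mut_Z: "mut_seq_hom D ls (B t) ` emb D (fold mut_matrix ls (B t)) ` Z (fold mu ls t) =
        emb D (B t) ` Z t" if ls: "ls \<in> lists (unfrozen D)" for ls
      using i t Delta_plus_fold[OF t ls] ls matrix_fold_mu[OF seeds ls, of t] by metis
    \<comment> \<open>The values of \<open>tw\<close> are prescribed only on \<open>UX\<close>. By
      (i), \<open>Z t\<close> is the image of a set of Laurent polynomials at each mutated seed, so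
      it lies in the intersection.\<close>
    have UX: "emb D (B t) ` Z t \<subseteq> UX D (B t)"
    proof -
      have "emb D (B t) ` Z t \<subseteq> mut_seq_hom D ls (B t) `
          emb D (fold mut_matrix ls (B t)) ` carrier (LPX D (fold mut_matrix ls (B t)))"
        if ls: "ls \<in> lists (unfrozen D)" for ls
        unfolding mut_Z[OF ls, symmetric] by (intro image_mono) (simp add: LPX_def)
      then show ?thesis unfolding UX_def by (rule INT_greatest)
    qed
    have "tw (emb D (B t) z) = mut_seq_hom D ks (B t) (emb D (B t') (varX z))" if "z \<in> Z t" for z
      using via UX that B' by (auto simp: twist_via_def)
    then have tw_image: "tw ` emb D (B t) ` Z t =
        mut_seq_hom D ks (B t) ` emb D (B t') ` varX ` Z t"
      by (simp add: image_image)
    have Z': "mut_seq_hom D ks (B t) ` emb D (B t') ` Z t' = emb D (B t) ` Z t"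
      using mut_Z[OF ks] by (simp add: B' t'_def)
    have "varX ` Z t \<subseteq> Z t'"
      unfolding image Zt' by blast
    \<comment> \<open>Writing the right-hand side as the image of \<open>Z t'\<close> puts the same
      map on both sides, so monotonicity of images suffices.\<close>
    then have "tw ` emb D (B t) ` Z t \<subseteq> emb D (B t) ` Z t"
      unfolding tw_image by (subst Z'[symmetric]) (intro image_mono)
    moreover have "varX ` Z t = Z t'" if "bij varX"
      unfolding image Zt'
      using surj_variation_exponent[OF addX scalar monom bij_is_surj[OF that]] by simp
    then have "tw ` emb D (B t) ` Z t = emb D (B t) ` Z t" if "bij varX"
      using that Z' unfolding tw_image by simp
    ultimately show ?thesis by blast
  qed
  show ?thesis
    using tw main unfolding twist_endomorphism_def twist_automorphism_def by blast
qed

end
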